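(* Let $B=(B_{mn})_{m,n\ge0}$ be an antisymmetric complex array with $\sum_{m,n}|B_{mn}|<\infty$ (in particular, any finitely supported antisymmetric $B$), and let $\Omega_B(X,Y)=\sum_{m,n}\alpha_m(X)\alpha_n(Y)B_{mn}$ for $X,Y\in\mathcal{A}$. Then $\Omega_B$ is a continuous $2$-cocycle on $\mathcal{A}$, with $$|\Omega_B(X,Y)|\le\Bigl(\sum_{m,n}|B_{mn}|\Bigr)\|X\|\,\|Y\|\qquad (X,Y\in\mathcal{A}),$$ and the assignment $B\mapsto[\Omega_B]\in H^2(\mathcal{A},\mathbb{C})$ is linear and injective on the space of such arrays. Consequently $H^2(\mathcal{A},\mathbb{C})$ is infinite-dimensional, and the central extensions $\widetilde{\mathcal{A}}_{\Omega_B}$ are pairwise inequivalent for distinct $B$.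
   Context: Let $(e_n)_{n\ge 0}$ be the canonical orthonormal basis of $\ell^2(\mathbb{Z}_{\ge 0})$ (inner product linear in the second argument). $U$ is the forward unilateral shift, $Ue_n=e_{n+1}$, and $Ef=\langle e_0,f\rangle e_0$. Let $\mathcal{A}=\mathrm{span}\{U^aE(U^* )^b,\ U^n: a,b,n\ge0\}$ (finite complex linear combinations), a Lie algebra under $[X,Y]=XY-YX$, normed by the operator norm $\|\cdot\|$. One has $U^aE(U^* )^b=|e_a\rangle\langle e_b|$, the operator $f\mapsto\langle e_b,f\rangle e_a$; put $\mathcal{A}_{\mathrm{edge}}=\mathrm{span}\{|e_a\rangle\langle e_b|:a,b\ge0\}$. Each $X\in\mathcal{A}$ has a unique decomposition $X=\sum_{m\ge0}\alpha_m(X)U^m+X_{\mathrm{edge}}$ with finitely many nonzero $\alpha_m(X)\in\mathbb{C}$ and $X_{\mathrm{edge}}\in\mathcal{A}_{\mathrm{edge}}$; this defines the linear functionals $\alpha_m$. Cohomology is that of the continuous (bounded in operator norm) Chevalley–Eilenberg complex of $\mathcal{A}$ with trivial coefficients $\mathbb{C}$: a continuous $1$-cochain is a bounded linear functional $\eta$ on $\mathcal{A}$, with $(d\eta)(X,Y)=\eta([X,Y])$; a continuous $2$-cocycle is a bounded antisymmetric bilinear form $\Omega$ with $\Omega([X,Y],Z)+\Omega([Y,Z],X)+\Omega([Z,X],Y)=0$; $H^2(\mathcal{A},\mathbb{C})$ is the space of continuous $2$-cocycles modulo coboundaries $d\eta$. A continuous $2$-cocycle $\Omega$ determines the central extension $0\to\mathbb{C}c\to\widetilde{\mathcal{A}}_\Omega\to\mathcal{A}\to0$,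 where $\widetilde{\mathcal{A}}_\Omega=\mathcal{A}\oplus\mathbb{C}c$ with bracket $[X\oplus sc,\,Y\oplus tc]_\Omega=[X,Y]\oplus\Omega(X,Y)c$ ($c$ central). Two central extensions are equivalent if there is a continuous Lie algebra isomorphism between them, with continuous inverse, inducing the identity on $\mathbb{C}c$ and on $\mathcal{A}$. *)

theory Defs
  imports "HOL-Analysis.Analysis"
begin

section \<open>Complex vector spaces\<close>

class scaleC = scaleR +
  fixes scaleC :: "complex \<Rightarrow> 'a \<Rightarrow> 'a"  (infixr \<open>*\<^sub>C\<close> 75)

class complex_vector = real_vector + scaleC +
  assumes scaleC_add_right: "c *\<^sub>C (x + y) = c *\<^sub>C x + c *\<^sub>C y"
    and scaleC_add_left: "(c + d) *\<^sub>C x = c *\<^sub>C x + d *\<^sub>C x"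
    and scaleC_scaleC: "c *\<^sub>C (d *\<^sub>C x) = (c * d) *\<^sub>C x"
    and scaleC_one: "1 *\<^sub>C x = x"
    and scaleR_scaleC: "r *\<^sub>R x = complex_of_real r *\<^sub>C x"

class complex_normed_vector = complex_vector + real_normed_vector +
  assumes norm_scaleC: "norm (c *\<^sub>C x) = cmod c * norm x"

global_interpretation cvec: vector_space "scaleC :: complex \<Rightarrow> 'a \<Rightarrow> 'a :: complex_vector"
  by unfold_locales (simp_all add: scaleC_add_right scaleC_add_left scaleC_scaleC scaleC_one)

instantiation complex :: complex_normed_vector
begin
definition scaleC_complex :: "complex \<Rightarrow> complex \<Rightarrow> complex" where "scaleC_complex c z = c * z"
instance
  by standard (simp_all add: scaleC_complex_def algebra_simps norm_mult scaleR_conv_of_real)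
end

instantiation prod :: (complex_vector, complex_vector) complex_vector
begin
definition scaleC_prod :: "complex \<Rightarrow> 'a \<times> 'b \<Rightarrow> 'a \<times> 'b"
  where "scaleC_prod c p = (c *\<^sub>C fst p, c *\<^sub>C snd p)"
instance
  by standard (simp_all add: scaleC_prod_def prod_eq_iff scaleC_add_right scaleC_add_left
      scaleC_scaleC scaleC_one scaleR_scaleC)
end

lemma bounded_linear_scaleC_right: "bounded_linear (\<lambda>x::'a::complex_normed_vector. c *\<^sub>C x)"
  by (rule bounded_linear_intro[where K = "cmod c"])
    (simp_all add: scaleC_add_right scaleR_scaleC scaleC_scaleC norm_scaleC mult.commute)

instantiation blinfun :: (real_normed_vector, complex_normed_vector) complex_normed_vector
begin

lift_definition scaleC_blinfun :: "complex \<Rightarrow> 'a \<Rightarrow>\<^sub>L 'b \<Rightarrow> 'a \<Rightarrow>\<^sub>L 'b" is "\<lambda>c f x. c *\<^sub>C f x"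
  by (rule bounded_linear_compose[OF bounded_linear_scaleC_right])

instance
proof
  fix c d :: complex and r :: real and x y :: "'a \<Rightarrow>\<^sub>L 'b"
  show "c *\<^sub>C (x + y) = c *\<^sub>C x + c *\<^sub>C y"
    by transfer (simp add: scaleC_add_right)
  show "(c + d) *\<^sub>C x = c *\<^sub>C x + d *\<^sub>C x"
    by transfer (simp add: scaleC_add_left)
  show "c *\<^sub>C (d *\<^sub>C x) = (c * d) *\<^sub>C x"
    by transfer (simp add: scaleC_scaleC)
  show "1 *\<^sub>C x = x"
    by transfer (simp add: scaleC_one)
  show "r *\<^sub>R x = complex_of_real r *\<^sub>C x"
    by transfer (simp add: scaleR_scaleC)
  have le: "norm (a *\<^sub>C z) \<le> cmod a * norm z" for a and z :: "'a \<Rightarrow>\<^sub>L 'b"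
  proof (rule norm_blinfun_bound)
    fix t
    have "norm (blinfun_apply (a *\<^sub>C z) t) = cmod a * norm (blinfun_apply z t)"
      by (simp add: scaleC_blinfun.rep_eq norm_scaleC)
    also have "\<dots> \<le> cmod a * (norm z * norm t)"
      by (rule mult_left_mono[OF norm_blinfun]) simp
    finally show "norm (blinfun_apply (a *\<^sub>C z) t) \<le> cmod a * norm z * norm t"
      by (simp add: mult.assoc)
  qed simp
  show "norm (c *\<^sub>C x) = cmod c * norm x"
  proof (cases "c = 0")
    case True
    have "(0::complex) *\<^sub>C x = 0" using le[of 0 x] by simp
    with True show ?thesis by simp
  next
    case False
    have "x = inverse c *\<^sub>C (c *\<^sub>C x)"
      using False by (intro blinfun_eqI) (simp add: scaleC_blinfun.rep_eq scaleC_scaleC scaleC_one)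
    then have "norm x \<le> cmod (inverse c) * norm (c *\<^sub>C x)"
      using le[of "inverse c" "c *\<^sub>C x"] by simp
    then have "cmod c * norm x \<le> norm (c *\<^sub>C x)"
      using mult_left_mono[of _ _ "cmod c"] False by (fastforce simp: norm_inverse simp flip: mult.assoc)
    with le[of c x] show ?thesis by simp
  qed
qed

end

section \<open>The Hilbert space of square-summable sequences\<close>

typedef ell2 = "{f :: nat \<Rightarrow> complex. summable (\<lambda>n. (cmod (f n))\<^sup>2)}"
  morphisms coord Abs_ell2
  by (rule exI[of _ "\<lambda>_. 0"]) simp

setup_lifting type_definition_ell2

lemma ell2_eqI: "(\<And>n. coord f n = coord g n) \<Longrightarrow> f = g"
  by (metis coord_inject ext)

lemma summable_sq: "summable (\<lambda>n. (cmod (coord f n))\<^sup>2)"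
  using coord by blast

lemma sq_add_bound: "(cmod (a + b))\<^sup>2 \<le> 2 * (cmod a)\<^sup>2 + 2 * (cmod b)\<^sup>2"
proof -
  have "(cmod (a + b))\<^sup>2 \<le> (cmod a + cmod b)\<^sup>2"
    by (rule power_mono[OF norm_triangle_ineq]) simp
  also have "\<dots> \<le> 2 * (cmod a)\<^sup>2 + 2 * (cmod b)\<^sup>2"
    using zero_le_power2[of "cmod a - cmod b"] by (simp add: power2_eq_square algebra_simps)
  finally show ?thesis .
qed

lemma summable_sq_add:
  assumes "summable (\<lambda>n. (cmod (f n))\<^sup>2)" and "summable (\<lambda>n. (cmod (g n))\<^sup>2)"
  shows "summable (\<lambda>n. (cmod (f n + g n))\<^sup>2)"
  by (rule summable_comparison_test'[where N = 0, OF summable_add[OF summable_mult[OF assms(1), of 2]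
        summable_mult[OF assms(2), of 2]]])
    (simp add: sq_add_bound)

lemma summable_sq_scale:
  assumes "summable (\<lambda>n. (cmod (f n))\<^sup>2)"
  shows "summable (\<lambda>n. (cmod (c * f n))\<^sup>2)"
  using summable_mult[OF assms, of "(cmod c)\<^sup>2"] by (simp add: norm_mult power_mult_distrib)

definition cinner :: "ell2 \<Rightarrow> ell2 \<Rightarrow> complex"
  where "cinner f g = (\<Sum>n. cnj (coord f n) * coord g n)"

lemma summable_cinner: "summable (\<lambda>n. cnj (coord f n) * coord g n)"
proof (rule summable_comparison_test'[where N = 0, OF summable_add[OF summable_sq[of f] summable_sq[of g]]])
  fix n
  have "0 \<le> (cmod (coord f n) - cmod (coord g n))\<^sup>2 + cmod (coord f n) ^ 2 + cmod (coord g n) ^ 2" by simp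
  then have "2 * (cmod (coord f n) * cmod (coord g n)) \<le> 2 * ((cmod (coord f n))\<^sup>2 + (cmod (coord g n))\<^sup>2)"
    by (simp add: power2_eq_square algebra_simps)
  then show "norm (cnj (coord f n) * coord g n) \<le> (cmod (coord f n))\<^sup>2 + (cmod (coord g n))\<^sup>2"
    by (simp add: norm_mult)
qed

instantiation ell2 :: complex_vector
begin

lift_definition zero_ell2 :: ell2 is "\<lambda>_. 0" by simp
lift_definition plus_ell2 :: "ell2 \<Rightarrow> ell2 \<Rightarrow> ell2" is "\<lambda>f g n. f n + g n"
  by (rule summable_sq_add)
lift_definition uminus_ell2 :: "ell2 \<Rightarrow> ell2" is "\<lambda>f n. - f n" by simp
lift_definition minus_ell2 :: "ell2 \<Rightarrow> ell2 \<Rightarrow> ell2" is "\<lambda>f g n. f n - g n"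
  subgoal for f g using summable_sq_add[of f "\<lambda>n. - g n"] by simp
  done
lift_definition scaleR_ell2 :: "real \<Rightarrow> ell2 \<Rightarrow> ell2" is "\<lambda>r f n. complex_of_real r * f n"
  by (rule summable_sq_scale)
lift_definition scaleC_ell2 :: "complex \<Rightarrow> ell2 \<Rightarrow> ell2" is "\<lambda>c f n. c * f n"
  by (rule summable_sq_scale)

instance
proof
  fix x y z :: ell2 and r s :: real and c d :: complex
  show "x + y + z = x + (y + z)" by transfer (simp add: add.assoc)
  show "x + y = y + x" by transfer (simp add: add.commute)
  show "0 + x = x" by transfer simp
  show "- x + x = 0" by transfer simp
  show "x - y = x + - y" by transfer simp
  show "r *\<^sub>R (x + y) = r *\<^sub>R x + r *\<^sub>R y" by transfer (simp add: algebra_simps)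
  show "(r + s) *\<^sub>R x = r *\<^sub>R x + s *\<^sub>R x" by transfer (simp add: algebra_simps)
  show "r *\<^sub>R s *\<^sub>R x = (r * s) *\<^sub>R x" by transfer (simp add: algebra_simps)
  show "1 *\<^sub>R x = x" by transfer simp
  show "c *\<^sub>C (x + y) = c *\<^sub>C x + c *\<^sub>C y" by transfer (simp add: algebra_simps)
  show "(c + d) *\<^sub>C x = c *\<^sub>C x + d *\<^sub>C x" by transfer (simp add: algebra_simps)
  show "c *\<^sub>C d *\<^sub>C x = (c * d) *\<^sub>C x" by transfer (simp add: algebra_simps)
  show "1 *\<^sub>C x = x" by transfer simp
  show "r *\<^sub>R x = complex_of_real r *\<^sub>C x" by transfer simp
qed

end

instantiation ell2 :: real_inner
begin

definition norm_ell2 :: "ell2 \<Rightarrow> real" where "norm_ell2 f = sqrt (\<Sum>n. (cmod (coord f n))\<^sup>2)"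
definition inner_ell2 :: "ell2 \<Rightarrow> ell2 \<Rightarrow> real" where "inner_ell2 f g = Re (cinner f g)"
definition sgn_ell2 :: "ell2 \<Rightarrow> ell2" where "sgn_ell2 f = f /\<^sub>R norm f"
definition dist_ell2 :: "ell2 \<Rightarrow> ell2 \<Rightarrow> real" where "dist_ell2 f g = norm (f - g)"
definition uniformity_ell2 :: "(ell2 \<times> ell2) filter"
  where [code del]: "uniformity_ell2 = (INF e\<in>{0<..}. principal {(x, y). dist x y < e})"
definition open_ell2 :: "ell2 set \<Rightarrow> bool"
  where [code del]: "open_ell2 S = (\<forall>x\<in>S. \<forall>\<^sub>F (x', y) in uniformity. x' = x \<longrightarrow> y \<in> S)"

instance
proof
  fix x y z :: ell2 and r :: real
  show "dist x y = norm (x - y)" by (rule dist_ell2_def)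
  show "sgn x = x /\<^sub>R norm x" by (rule sgn_ell2_def)
  show "uniformity = (INF e\<in>{0<..}. principal {(x::ell2, y). dist x y < e})" by (rule uniformity_ell2_def)
  show "open S = (\<forall>x\<in>S. \<forall>\<^sub>F (x', y) in uniformity. x' = x \<longrightarrow> y \<in> S)" for S :: "ell2 set"
    by (rule open_ell2_def)
  have "cinner y x = cnj (cinner x y)"
    unfolding cinner_def
    using bounded_linear.suminf[OF bounded_linear_cnj summable_cinner[of x y]]
    by (simp add: mult.commute)
  then show "inner x y = inner y x" by (simp add: inner_ell2_def)
  have "cinner (x + y) z = cinner x z + cinner y z"
    using suminf_add[OF summable_cinner[of x z] summable_cinner[of y z]]
    by (simp add: cinner_def plus_ell2.rep_eq algebra_simps)
  then show "inner (x + y) z = inner x z + inner y z" by (simp add: inner_ell2_def)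
  have "cinner (r *\<^sub>R x) y = of_real r * cinner x y"
    using suminf_mult[OF summable_cinner[of x y], of "of_real r"]
    by (simp add: cinner_def scaleR_ell2.rep_eq mult.assoc)
  then show "inner (r *\<^sub>R x) y = r * inner x y" by (simp add: inner_ell2_def)
  have "cinner x x = of_real (\<Sum>n. (cmod (coord x n))\<^sup>2)"
    using suminf_of_real[OF summable_sq[of x], where 'a = complex]
    by (simp add: cinner_def mult.commute flip: complex_norm_square)
  then have eq: "inner x x = (\<Sum>n. (cmod (coord x n))\<^sup>2)" by (simp add: inner_ell2_def)
  then show "0 \<le> inner x x" by (simp add: suminf_nonneg summable_sq)
  have "inner x x = 0 \<longleftrightarrow> (\<forall>n. coord x n = 0)"
    unfolding eq by (subst suminf_eq_zero_iff[OF summable_sq]) auto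
  also have "\<dots> \<longleftrightarrow> x = 0" by transfer auto
  finally show "inner x x = 0 \<longleftrightarrow> x = 0" .
  show "norm x = sqrt (inner x x)" by (simp add: eq norm_ell2_def)
qed

end

instance ell2 :: complex_normed_vector
proof
  fix c :: complex and x :: ell2
  show "norm (c *\<^sub>C x) = cmod c * norm x"
    using suminf_mult[OF summable_sq[of x], of "(cmod c)\<^sup>2"]
    by (simp add: norm_ell2_def scaleC_ell2.rep_eq norm_mult power_mult_distrib real_sqrt_mult)
qed

lift_definition basis_vec :: "nat \<Rightarrow> ell2" is "\<lambda>k n. if n = k then 1 else 0"
  subgoal for k
    by (rule summable_finite[of "{k}"]) auto
  done

lemma cinner_basis_vec: "cinner (basis_vec k) f = coord f k"
  unfolding cinner_def basis_vec.rep_eq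
  by (subst suminf_finite[of "{k}"]) auto

lemma coord_le_norm: "cmod (coord f k) \<le> norm f"
proof -
  have "(\<Sum>n\<in>{k}. (cmod (coord f n))\<^sup>2) \<le> (\<Sum>n. (cmod (coord f n))\<^sup>2)"
    by (rule sum_le_suminf[OF summable_sq]) auto
  then show ?thesis unfolding norm_ell2_def by (intro real_le_rsqrt) simp
qed

section \<open>The operators\<close>

text \<open>Bounded operators are elements of \<^typ>\<open>ell2 \<Rightarrow>\<^sub>L ell2\<close>, whose norm is the operator norm.
  This type consists of all bounded real-linear maps; every operator that occurs below is
  complex-linear, and \<open>*\<^sub>C\<close> acts by \<open>(c *\<^sub>C T) f = c *\<^sub>C T f\<close>.\<close>

lift_definition shift_fun :: "ell2 \<Rightarrow> ell2" is "\<lambda>f n. case n of 0 \<Rightarrow> 0 | Suc k \<Rightarrow> f k"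
  subgoal for f by (subst summable_Suc_iff[symmetric]) simp
  done

lemma norm_shift_fun: "norm (shift_fun f) = norm f"
  using suminf_split_head[OF summable_sq[of "shift_fun f"]]
  by (simp add: norm_ell2_def shift_fun.rep_eq)

lift_definition shift_op :: "ell2 \<Rightarrow>\<^sub>L ell2" is shift_fun
proof (rule bounded_linear_intro[where K = 1])
  show "shift_fun (x + y) = shift_fun x + shift_fun y" for x y
    by transfer (auto split: nat.split)
  show "shift_fun (r *\<^sub>R x) = r *\<^sub>R shift_fun x" for r x
    by transfer (auto split: nat.split)
qed (simp add: norm_shift_fun)

lemma coord_shift_op: "coord (blinfun_apply shift_op f) n = (case n of 0 \<Rightarrow> 0 | Suc k \<Rightarrow> coord f k)"
  by (simp add: shift_op.rep_eq shift_fun.rep_eq)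

lemma shift_op_basis_vec: "blinfun_apply shift_op (basis_vec n) = basis_vec (Suc n)"
  by (rule ell2_eqI) (auto simp: coord_shift_op basis_vec.rep_eq split: nat.split)

definition adjoint_op :: "(ell2 \<Rightarrow>\<^sub>L ell2) \<Rightarrow> (ell2 \<Rightarrow>\<^sub>L ell2)"
  where "adjoint_op T =
    (THE S. \<forall>f g. cinner (blinfun_apply S f) g = cinner f (blinfun_apply T g))"

lift_definition ketbra :: "nat \<Rightarrow> nat \<Rightarrow> ell2 \<Rightarrow>\<^sub>L ell2"
  is "\<lambda>a b f. cinner (basis_vec b) f *\<^sub>C basis_vec a"
  subgoal for a b
  proof (rule bounded_linear_intro[where K = "norm (basis_vec a)"])
    show "norm (cinner (basis_vec b) x *\<^sub>C basis_vec a) \<le> norm x * norm (basis_vec a)" for x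
      by (simp add: norm_scaleC cinner_basis_vec mult_right_mono coord_le_norm)
  qed (simp_all add: cinner_basis_vec plus_ell2.rep_eq scaleC_ell2.rep_eq scaleC_add_left
      scaleR_scaleC scaleC_scaleC)
  done

abbreviation E_op :: "ell2 \<Rightarrow>\<^sub>L ell2" where "E_op \<equiv> ketbra 0 0"

definition op_power :: "(ell2 \<Rightarrow>\<^sub>L ell2) \<Rightarrow> nat \<Rightarrow> (ell2 \<Rightarrow>\<^sub>L ell2)"
  where "op_power T n = ((o\<^sub>L) T ^^ n) id_blinfun"

lemma op_power_0: "op_power T 0 = id_blinfun"
  and op_power_Suc: "op_power T (Suc n) = T o\<^sub>L op_power T n"
  by (simp_all add: op_power_def)

definition alg_generators :: "(ell2 \<Rightarrow>\<^sub>L ell2) set"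
  where "alg_generators =
    {op_power shift_op a o\<^sub>L E_op o\<^sub>L op_power (adjoint_op shift_op) b |a b. True}
    \<union> {op_power shift_op n |n. True}"

definition alg_edge :: "(ell2 \<Rightarrow>\<^sub>L ell2) set"
  where "alg_edge = cvec.span {ketbra a b |a b. True}"

subsection \<open>Products of the generators\<close>

lift_definition back_fun :: "ell2 \<Rightarrow> ell2" is "\<lambda>f n. f (Suc n)"
  by (simp add: summable_Suc_iff[of "\<lambda>n. (cmod (_ n))\<^sup>2"])

lemma norm_back_fun: "norm (back_fun f) \<le> norm f"
  using suminf_split_head[OF summable_sq[of f]]
  by (simp add: norm_ell2_def back_fun.rep_eq)

lift_definition back_op :: "ell2 \<Rightarrow>\<^sub>L ell2" is back_fun
proof (rule bounded_linear_intro[where K = 1])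
  show "back_fun (x + y) = back_fun x + back_fun y" for x y by transfer simp
  show "back_fun (r *\<^sub>R x) = r *\<^sub>R back_fun x" for r x by transfer simp
qed (simp add: norm_back_fun)

lemma coord_back_op: "coord (blinfun_apply back_op f) n = coord f (Suc n)"
  by (simp add: back_op.rep_eq back_fun.rep_eq)

lemma cinner_commute: "cinner g f = cnj (cinner f g)"
  unfolding cinner_def
  using bounded_linear.suminf[OF bounded_linear_cnj summable_cinner[of f g]]
  by (simp add: mult.commute)

lemma cinner_basis_vec_right: "cinner f (basis_vec k) = cnj (coord f k)"
  by (subst cinner_commute) (simp add: cinner_basis_vec)

lemma adjoint_shift_op: "adjoint_op shift_op = back_op"
  unfolding adjoint_op_def
proof (rule the_equality)
  show "\<forall>f g. cinner (blinfun_apply back_op f) g = cinner f (blinfun_apply shift_op g)"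
  proof (intro allI)
    fix f g
    show "cinner (blinfun_apply back_op f) g = cinner f (blinfun_apply shift_op g)"
      using suminf_split_head[OF summable_cinner[of f "blinfun_apply shift_op g"]]
      by (simp add: cinner_def coord_back_op coord_shift_op)
  qed
  fix S
  assume *: "\<forall>f g. cinner (blinfun_apply S f) g = cinner f (blinfun_apply shift_op g)"
  show "S = back_op"
  proof (rule blinfun_eqI, rule ell2_eqI)
    fix f n
    have "cnj (coord (blinfun_apply S f) n) = cnj (coord f (Suc n))"
      using *[rule_format, of f "basis_vec n"]
      by (simp add: cinner_basis_vec_right shift_op_basis_vec)
    then show "coord (blinfun_apply S f) n = coord (blinfun_apply back_op f) n"
      by (simp add: coord_back_op)
  qed
qed

lemma coord_shift_power:
  "coord (blinfun_apply (op_power shift_op a) f) n = (if n < a then 0 else coord f (n - a))"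
  by (induction a arbitrary: n) (auto simp: op_power_0 op_power_Suc coord_shift_op split: nat.split)

lemma coord_back_power: "coord (blinfun_apply (op_power back_op b) f) n = coord f (n + b)"
  by (induction b arbitrary: n) (auto simp: op_power_0 op_power_Suc coord_back_op)

lemma coord_ketbra: "coord (blinfun_apply (ketbra a b) f) n = (if n = a then coord f b else 0)"
  by (simp add: ketbra.rep_eq cinner_basis_vec scaleC_ell2.rep_eq basis_vec.rep_eq)

lemma ketbra_generator:
  "op_power shift_op a o\<^sub>L E_op o\<^sub>L op_power (adjoint_op shift_op) b = ketbra a b"
  by (rule blinfun_eqI, rule ell2_eqI)
    (auto simp: adjoint_shift_op coord_shift_power coord_back_power coord_ketbra)

lemma alg_generators_eq: "alg_generators = {ketbra a b |a b. True} \<union> {op_power shift_op n |n. True}"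
  unfolding alg_generators_def ketbra_generator ..

lemma coord_zero: "coord 0 n = 0"
  by (simp add: zero_ell2.rep_eq)

lemma ketbra_ketbra: "ketbra a b o\<^sub>L ketbra c d = (if b = c then ketbra a d else 0)"
  by (rule blinfun_eqI, rule ell2_eqI) (auto simp: coord_ketbra coord_zero)

lemma shift_ketbra: "op_power shift_op n o\<^sub>L ketbra a b = ketbra (n + a) b"
  by (rule blinfun_eqI, rule ell2_eqI) (auto simp: coord_ketbra coord_shift_power)

lemma ketbra_shift: "ketbra a b o\<^sub>L op_power shift_op n = (if n \<le> b then ketbra a (b - n) else 0)"
  by (rule blinfun_eqI, rule ell2_eqI) (auto simp: coord_ketbra coord_shift_power coord_zero)

lemma shift_shift: "op_power shift_op m o\<^sub>L op_power shift_op n = op_power shift_op (m + n)"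
  by (rule blinfun_eqI, rule ell2_eqI) (auto simp: coord_shift_power add.commute)

lemma generators_compose:
  assumes "X \<in> alg_generators" and "Y \<in> alg_generators"
  shows "X o\<^sub>L Y \<in> cvec.span alg_generators"
proof -
  have "X o\<^sub>L Y \<in> insert 0 alg_generators"
    using assms
    by (auto simp: alg_generators_eq ketbra_ketbra shift_ketbra ketbra_shift shift_shift; blast)
  then show ?thesis
    by (auto intro: cvec.span_base cvec.span_zero)
qed

lemma span_generators_complex_linear:
  assumes "X \<in> cvec.span alg_generators"
  shows "blinfun_apply X (c *\<^sub>C f) = c *\<^sub>C blinfun_apply X f"
  using assms
proof (induction rule: cvec.span_induct_alt)
  case base
  show ?case by simp
next
  case (step d x y)
  have "blinfun_apply x (c *\<^sub>C f) = c *\<^sub>C blinfun_apply x f"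
    using step(1)
    by (auto simp: alg_generators_eq coord_ketbra coord_shift_power scaleC_ell2.rep_eq intro!: ell2_eqI)
  with step show ?case
    by (simp add: blinfun.add_left scaleC_blinfun.rep_eq scaleC_add_right scaleC_scaleC mult.commute)
qed

lemma span_generators_compose:
  assumes X: "X \<in> cvec.span alg_generators" and Y: "Y \<in> cvec.span alg_generators"
  shows "X o\<^sub>L Y \<in> cvec.span alg_generators"
  using X
proof (induction rule: cvec.span_induct_alt)
  case base
  have "0 o\<^sub>L Y = 0" by (rule blinfun_eqI) simp
  then show ?case by (simp add: cvec.span_zero)
next
  case (step c x z)
  have "x o\<^sub>L Y \<in> cvec.span alg_generators"
    using Y
  proof (induction rule: cvec.span_induct_alt)
    case base
    have "x o\<^sub>L 0 = 0" by (rule blinfun_eqI) simp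
    then show ?case by (simp add: cvec.span_zero)
  next
    case (step d y w)
    have "x o\<^sub>L (d *\<^sub>C y + w) = d *\<^sub>C (x o\<^sub>L y) + (x o\<^sub>L w)"
      by (rule blinfun_eqI)
        (simp add: blinfun.add_left blinfun.add_right scaleC_blinfun.rep_eq
          span_generators_complex_linear[OF cvec.span_base[OF \<open>x \<in> alg_generators\<close>]])
    then show ?case
      using step generators_compose[OF \<open>x \<in> alg_generators\<close> step(1)]
      by (simp add: cvec.span_add cvec.span_scale)
  qed
  moreover have "(c *\<^sub>C x + z) o\<^sub>L Y = c *\<^sub>C (x o\<^sub>L Y) + (z o\<^sub>L Y)"
    by (rule blinfun_eqI) (simp add: blinfun.add_left scaleC_blinfun.rep_eq)
  ultimately show ?case
    using step by (simp add: cvec.span_add cvec.span_scale)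
qed

section \<open>The normed Lie algebra\<close>

typedef alg = "cvec.span alg_generators"
  morphisms op_of Abs_alg
  using cvec.span_zero by blast

setup_lifting type_definition_alg

instantiation alg :: complex_vector
begin

lift_definition zero_alg :: alg is 0 by (rule cvec.span_zero)
lift_definition plus_alg :: "alg \<Rightarrow> alg \<Rightarrow> alg" is "(+)" by (rule cvec.span_add)
lift_definition uminus_alg :: "alg \<Rightarrow> alg" is uminus by (rule cvec.span_neg)
lift_definition minus_alg :: "alg \<Rightarrow> alg \<Rightarrow> alg" is "(-)" by (rule cvec.span_diff)
lift_definition scaleR_alg :: "real \<Rightarrow> alg \<Rightarrow> alg" is scaleR
  by (simp add: scaleR_scaleC cvec.span_scale)
lift_definition scaleC_alg :: "complex \<Rightarrow> alg \<Rightarrow> alg" is scaleC by (rule cvec.span_scale)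

instance
proof
  fix x y z :: alg and r s :: real and c d :: complex
  show "x + y + z = x + (y + z)" by transfer (simp add: add.assoc)
  show "x + y = y + x" by transfer (simp add: add.commute)
  show "0 + x = x" by transfer simp
  show "- x + x = 0" by transfer simp
  show "x - y = x + - y" by transfer simp
  show "r *\<^sub>R (x + y) = r *\<^sub>R x + r *\<^sub>R y" by transfer (simp add: algebra_simps)
  show "(r + s) *\<^sub>R x = r *\<^sub>R x + s *\<^sub>R x" by transfer (simp add: algebra_simps)
  show "r *\<^sub>R s *\<^sub>R x = (r * s) *\<^sub>R x" by transfer simp
  show "1 *\<^sub>R x = x" by transfer simp
  show "c *\<^sub>C (x + y) = c *\<^sub>C x + c *\<^sub>C y" by transfer (rule scaleC_add_right)
  show "(c + d) *\<^sub>C x = c *\<^sub>C x + d *\<^sub>C x" by transfer (rule scaleC_add_left)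
  show "c *\<^sub>C d *\<^sub>C x = (c * d) *\<^sub>C x" by transfer (rule scaleC_scaleC)
  show "1 *\<^sub>C x = x" by transfer (rule scaleC_one)
  show "r *\<^sub>R x = complex_of_real r *\<^sub>C x" by transfer (rule scaleR_scaleC)
qed

end

instantiation alg :: complex_normed_vector
begin

lift_definition norm_alg :: "alg \<Rightarrow> real" is norm .
definition sgn_alg :: "alg \<Rightarrow> alg" where "sgn_alg X = X /\<^sub>R norm X"
definition dist_alg :: "alg \<Rightarrow> alg \<Rightarrow> real" where "dist_alg X Y = norm (X - Y)"
definition uniformity_alg :: "(alg \<times> alg) filter"
  where [code del]: "uniformity_alg = (INF e\<in>{0<..}. principal {(x, y). dist x y < e})"
definition open_alg :: "alg set \<Rightarrow> bool"
  where [code del]: "open_alg S = (\<forall>x\<in>S. \<forall>\<^sub>F (x', y) in uniformity. x' = x \<longrightarrow> y \<in> S)"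

instance
proof
  fix x y :: alg and r :: real and c :: complex
  show "dist x y = norm (x - y)" by (rule dist_alg_def)
  show "sgn x = x /\<^sub>R norm x" by (rule sgn_alg_def)
  show "uniformity = (INF e\<in>{0<..}. principal {(x::alg, y). dist x y < e})" by (rule uniformity_alg_def)
  show "open S = (\<forall>x\<in>S. \<forall>\<^sub>F (x', y) in uniformity. x' = x \<longrightarrow> y \<in> S)" for S :: "alg set"
    by (rule open_alg_def)
  show "norm x = 0 \<longleftrightarrow> x = 0" by transfer simp
  show "norm (x + y) \<le> norm x + norm y" by transfer (rule norm_triangle_ineq)
  show "norm (r *\<^sub>R x) = \<bar>r\<bar> * norm x" by transfer simp
  show "norm (c *\<^sub>C x) = cmod c * norm x" by transfer (rule norm_scaleC)
qed

end

lift_definition bracket :: "alg \<Rightarrow> alg \<Rightarrow> alg" is "\<lambda>X Y. (X o\<^sub>L Y) - (Y o\<^sub>L X)"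
  by (intro cvec.span_diff span_generators_compose)

definition is_decomposition :: "alg \<Rightarrow> (nat \<Rightarrow> complex) \<Rightarrow> bool"
  where "is_decomposition X a \<longleftrightarrow> finite {m. a m \<noteq> 0} \<and>
    op_of X - (\<Sum>m | a m \<noteq> 0. a m *\<^sub>C op_power shift_op m) \<in> alg_edge"

definition alpha :: "nat \<Rightarrow> alg \<Rightarrow> complex"
  where "alpha m X = (THE a. is_decomposition X a) m"

lemma edge_eventually_zero:
  assumes "X \<in> alg_edge"
  shows "\<exists>N. \<forall>n\<ge>N. blinfun_apply X (basis_vec n) = 0"
  using assms unfolding alg_edge_def
proof (induction rule: cvec.span_induct_alt)
  case base
  show ?case by simp
next
  case (step c x y)
  from step(1) obtain a b where x: "x = ketbra a b" by blast
  from step(2) obtain N where N: "\<forall>n\<ge>N. blinfun_apply y (basis_vec n) = 0" by blast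
  have "blinfun_apply x (basis_vec n) = 0" if "n \<ge> Suc b" for n
    using that by (intro ell2_eqI) (auto simp: x coord_ketbra basis_vec.rep_eq coord_zero)
  with N have "\<forall>n\<ge>max N (Suc b). blinfun_apply (c *\<^sub>C x + y) (basis_vec n) = 0"
    by (simp add: blinfun.add_left scaleC_blinfun.rep_eq)
  then show ?case by blast
qed

lemma coord_sum: "coord (\<Sum>i\<in>I. f i) n = (\<Sum>i\<in>I. coord (f i) n)"
  by (induction I rule: infinite_finite_induct) (auto simp: coord_zero plus_ell2.rep_eq)

lemma sum_shift_coord:
  assumes "finite K" and "{m. a m \<noteq> 0} \<subseteq> K"
  shows "coord (blinfun_apply (\<Sum>m | a m \<noteq> 0. a m *\<^sub>C op_power shift_op m) (basis_vec n)) (n + k) = a k"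
proof -
  have "coord (blinfun_apply (\<Sum>m | a m \<noteq> 0. a m *\<^sub>C op_power shift_op m) (basis_vec n)) (n + k)
      = (\<Sum>m | a m \<noteq> 0. a m * (if m = k then 1 else 0))"
    unfolding blinfun.sum_left coord_sum
    by (rule sum.cong)
      (auto simp: scaleC_blinfun.rep_eq scaleC_ell2.rep_eq coord_shift_power basis_vec.rep_eq)
  also have "\<dots> = a k"
    using finite_subset[OF assms(2,1)] by (simp add: sum.delta if_distrib cong: if_cong)
  finally show ?thesis .
qed

lemma decomposition_unique:
  assumes "is_decomposition X a" and "is_decomposition X b"
  shows "a = b"
proof
  fix k
  let ?S = "\<lambda>a. \<Sum>m | a m \<noteq> 0. a m *\<^sub>C op_power shift_op m"
  have "(op_of X - ?S b) - (op_of X - ?S a) \<in> alg_edge"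
    using assms unfolding is_decomposition_def alg_edge_def by (blast intro: cvec.span_diff)
  then obtain N where "\<forall>n\<ge>N. blinfun_apply ((op_of X - ?S b) - (op_of X - ?S a)) (basis_vec n) = 0"
    using edge_eventually_zero by blast
  then have "blinfun_apply (?S a) (basis_vec N) = blinfun_apply (?S b) (basis_vec N)"
    by (simp add: blinfun.diff_left)
  then have "coord (blinfun_apply (?S a) (basis_vec N)) (N + k) = coord (blinfun_apply (?S b) (basis_vec N)) (N + k)"
    by (rule arg_cong)
  then show "a k = b k"
    using assms by (simp add: sum_shift_coord[OF _ order_refl] is_decomposition_def)
qed

lemma decomposition_exists: "\<exists>a. is_decomposition X a"
proof -
  have "\<exists>a. finite {m. a m \<noteq> 0} \<and> T - (\<Sum>m | a m \<noteq> 0. a m *\<^sub>C op_power shift_op m) \<in> alg_edge"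
    if "T \<in> cvec.span alg_generators" for T
    using that
  proof (induction rule: cvec.span_induct_alt)
    case base
    show ?case by (rule exI[of _ "\<lambda>_. 0"]) (simp add: alg_edge_def cvec.span_zero)
  next
    case (step c x y)
    from step(2) obtain a where fin: "finite {m. a m \<noteq> 0}"
      and edge: "y - (\<Sum>m | a m \<noteq> 0. a m *\<^sub>C op_power shift_op m) \<in> alg_edge" by blast
    from step(1) consider p q where "x = ketbra p q" | n where "x = op_power shift_op n"
      by (auto simp: alg_generators_eq)
    then show ?case
    proof cases
      case 1
      have "c *\<^sub>C x \<in> alg_edge"
        unfolding alg_edge_def 1 by (intro cvec.span_scale cvec.span_base) blast
      with edge have "c *\<^sub>C x + (y - (\<Sum>m | a m \<noteq> 0. a m *\<^sub>C op_power shift_op m)) \<in> alg_edge"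
        unfolding alg_edge_def by (intro cvec.span_add)
      with fin show ?thesis by (intro exI[of _ a]) (simp add: add_diff_eq)
    next
      case 2
      let ?b = "a(n := a n + c)"
      let ?K = "insert n {m. a m \<noteq> 0}"
      have sub: "{m. ?b m \<noteq> 0} \<subseteq> ?K" by auto
      have finK: "finite ?K" using fin by simp
      have "(\<Sum>m | ?b m \<noteq> 0. ?b m *\<^sub>C op_power shift_op m) = (\<Sum>m\<in>?K. ?b m *\<^sub>C op_power shift_op m)"
        by (rule sum.mono_neutral_left[OF finK sub]) auto
      also have "\<dots> = (\<Sum>m\<in>?K. a m *\<^sub>C op_power shift_op m + (if m = n then c *\<^sub>C op_power shift_op n else 0))"
        by (rule sum.cong) (auto simp: scaleC_add_left)
      also have "\<dots> = (\<Sum>m\<in>?K. a m *\<^sub>C op_power shift_op m) + c *\<^sub>C x"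
        unfolding sum.distrib using finK by (simp add: 2 sum.delta)
      also have "(\<Sum>m\<in>?K. a m *\<^sub>C op_power shift_op m) = (\<Sum>m | a m \<noteq> 0. a m *\<^sub>C op_power shift_op m)"
        by (rule sum.mono_neutral_right[OF finK]) auto
      finally have "c *\<^sub>C x + y - (\<Sum>m | ?b m \<noteq> 0. ?b m *\<^sub>C op_power shift_op m)
          = y - (\<Sum>m | a m \<noteq> 0. a m *\<^sub>C op_power shift_op m)" by simp
      with edge have "c *\<^sub>C x + y - (\<Sum>m | ?b m \<noteq> 0. ?b m *\<^sub>C op_power shift_op m) \<in> alg_edge"
        by metis
      with finite_subset[OF sub finK] show ?thesis by blast
    qed
  qed
  then show ?thesis unfolding is_decomposition_def using op_of by blast
qed

lemma decomposition_alpha: "is_decomposition X (\<lambda>m. alpha m X)"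
  unfolding alpha_def using theI[of "is_decomposition X"] decomposition_exists decomposition_unique
  by blast

section \<open>Continuous cohomology in degree two\<close>

definition continuous_1cochain :: "(alg \<Rightarrow> complex) \<Rightarrow> bool"
  where "continuous_1cochain \<eta> \<longleftrightarrow> bounded_linear \<eta> \<and> (\<forall>c X. \<eta> (c *\<^sub>C X) = c * \<eta> X)"

definition coboundary :: "(alg \<Rightarrow> complex) \<Rightarrow> alg \<Rightarrow> alg \<Rightarrow> complex"
  where "coboundary \<eta> X Y = \<eta> (bracket X Y)"

definition continuous_2cocycle :: "(alg \<Rightarrow> alg \<Rightarrow> complex) \<Rightarrow> bool"
  where "continuous_2cocycle \<Omega> \<longleftrightarrow>
    bounded_bilinear \<Omega> \<and>
    (\<forall>c X Y. \<Omega> (c *\<^sub>C X) Y = c * \<Omega> X Y) \<and> (\<forall>c X Y. \<Omega> X (c *\<^sub>C Y) = c * \<Omega> X Y) \<and>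
    (\<forall>X Y. \<Omega> X Y = - \<Omega> Y X) \<and>
    (\<forall>X Y Z. \<Omega> (bracket X Y) Z + \<Omega> (bracket Y Z) X + \<Omega> (bracket Z X) Y = 0)"

definition cohomologous :: "(alg \<Rightarrow> alg \<Rightarrow> complex) \<Rightarrow> (alg \<Rightarrow> alg \<Rightarrow> complex) \<Rightarrow> bool"
  where "cohomologous \<Omega> \<Omega>' \<longleftrightarrow> continuous_2cocycle \<Omega> \<and> continuous_2cocycle \<Omega>' \<and>
    (\<exists>\<eta>. continuous_1cochain \<eta> \<and> (\<forall>X Y. \<Omega> X Y - \<Omega>' X Y = coboundary \<eta> X Y))"

lemma continuous_1cochain_zero: "continuous_1cochain (\<lambda>_. 0)"
  by (simp add: continuous_1cochain_def)

lemma continuous_1cochain_add: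
  "continuous_1cochain \<eta> \<Longrightarrow> continuous_1cochain \<theta> \<Longrightarrow> continuous_1cochain (\<lambda>X. \<eta> X + \<theta> X)"
  by (auto simp: continuous_1cochain_def bounded_linear_add algebra_simps)

lemma continuous_1cochain_scale:
  "continuous_1cochain \<eta> \<Longrightarrow> continuous_1cochain (\<lambda>X. c * \<eta> X)"
  by (auto simp: continuous_1cochain_def bounded_linear_const_mult algebra_simps)

lemma continuous_2cocycle_zero: "continuous_2cocycle (\<lambda>_ _. 0)"
  unfolding continuous_2cocycle_def bounded_bilinear_def by (auto intro: exI[of _ 0])

lemma continuous_2cocycle_add:
  assumes "continuous_2cocycle \<Omega>" and "continuous_2cocycle \<Psi>"
  shows "continuous_2cocycle (\<lambda>X Y. \<Omega> X Y + \<Psi> X Y)"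
proof -
  interpret O: bounded_bilinear \<Omega> using assms(1) by (simp add: continuous_2cocycle_def)
  interpret P: bounded_bilinear \<Psi> using assms(2) by (simp add: continuous_2cocycle_def)
  obtain K where K: "\<And>X Y. norm (\<Omega> X Y) \<le> norm X * norm Y * K" using O.bounded by blast
  obtain L where L: "\<And>X Y. norm (\<Psi> X Y) \<le> norm X * norm Y * L" using P.bounded by blast
  have bb: "bounded_bilinear (\<lambda>X Y. \<Omega> X Y + \<Psi> X Y)"
  proof
    show "\<exists>M. \<forall>X Y. norm (\<Omega> X Y + \<Psi> X Y) \<le> norm X * norm Y * M"
    proof (intro exI allI)
      fix X Y
      show "norm (\<Omega> X Y + \<Psi> X Y) \<le> norm X * norm Y * (K + L)"
        using norm_triangle_ineq[of "\<Omega> X Y" "\<Psi> X Y"] K[of X Y] L[of X Y]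
        by (simp add: distrib_left)
    qed
  qed (simp_all add: O.add_left O.add_right P.add_left P.add_right O.scaleR_left O.scaleR_right
      P.scaleR_left P.scaleR_right scaleR_add_right)
  have anti: "\<Omega> X Y + \<Psi> X Y = - (\<Omega> Y X + \<Psi> Y X)" for X Y
    using assms unfolding continuous_2cocycle_def by (metis minus_add_distrib)
  have jac: "(\<Omega> (bracket X Y) Z + \<Psi> (bracket X Y) Z) + (\<Omega> (bracket Y Z) X + \<Psi> (bracket Y Z) X)
      + (\<Omega> (bracket Z X) Y + \<Psi> (bracket Z X) Y) = 0" for X Y Z
  proof -
    have "(\<Omega> (bracket X Y) Z + \<Omega> (bracket Y Z) X + \<Omega> (bracket Z X) Y)
        + (\<Psi> (bracket X Y) Z + \<Psi> (bracket Y Z) X + \<Psi> (bracket Z X) Y) = 0"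
      using assms unfolding continuous_2cocycle_def by (metis add.right_neutral)
    then show ?thesis by (simp only: ac_simps)
  qed
  have "\<Omega> (c *\<^sub>C X) Y + \<Psi> (c *\<^sub>C X) Y = c * (\<Omega> X Y + \<Psi> X Y)"
    and "\<Omega> X (c *\<^sub>C Y) + \<Psi> X (c *\<^sub>C Y) = c * (\<Omega> X Y + \<Psi> X Y)" for c X Y
    using assms unfolding continuous_2cocycle_def by (metis distrib_left)+
  then show ?thesis
    unfolding continuous_2cocycle_def using bb anti jac by blast
qed

lemma continuous_2cocycle_scale:
  assumes "continuous_2cocycle \<Omega>"
  shows "continuous_2cocycle (\<lambda>X Y. c * \<Omega> X Y)"
proof -
  have bb: "bounded_bilinear (\<lambda>X Y. c * \<Omega> X Y)"
  proof -
    interpret O: bounded_bilinear \<Omega> using assms by (simp add: continuous_2cocycle_def)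
    obtain K where K: "\<And>X Y. norm (\<Omega> X Y) \<le> norm X * norm Y * K" using O.bounded by blast
    show ?thesis
    proof
      show "\<exists>M. \<forall>X Y. norm (c * \<Omega> X Y) \<le> norm X * norm Y * M"
      proof (intro exI allI)
        fix X Y
        show "norm (c * \<Omega> X Y) \<le> norm X * norm Y * (cmod c * K)"
          using mult_left_mono[OF K[of X Y], of "cmod c"] by (simp add: norm_mult ac_simps)
      qed
    qed (simp_all add: O.add_left O.add_right O.scaleR_left O.scaleR_right distrib_left)
  qed
  have anti: "c * \<Omega> X Y = - (c * \<Omega> Y X)" for X Y
    using assms unfolding continuous_2cocycle_def by (metis mult_minus_right)
  have jac: "c * \<Omega> (bracket X Y) Z + c * \<Omega> (bracket Y Z) X + c * \<Omega> (bracket Z X) Y = 0" for X Y Z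
    using assms unfolding continuous_2cocycle_def by (metis distrib_left mult_zero_right)
  have "c * \<Omega> (d *\<^sub>C X) Y = d * (c * \<Omega> X Y)" and "c * \<Omega> X (d *\<^sub>C Y) = d * (c * \<Omega> X Y)" for d X Y
    using assms unfolding continuous_2cocycle_def by (metis mult.left_commute)+
  then show ?thesis
    unfolding continuous_2cocycle_def using bb anti jac by blast
qed

lemma cohomologous_refl: "continuous_2cocycle \<Omega> \<Longrightarrow> cohomologous \<Omega> \<Omega>"
  unfolding cohomologous_def using continuous_1cochain_zero by (auto simp: coboundary_def)

lemma cohomologous_add:
  assumes "cohomologous \<Omega> \<Omega>'" and "cohomologous \<Psi> \<Psi>'"
  shows "cohomologous (\<lambda>X Y. \<Omega> X Y + \<Psi> X Y) (\<lambda>X Y. \<Omega>' X Y + \<Psi>' X Y)"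
proof -
  obtain \<eta> \<theta> where *: "continuous_1cochain \<eta>" "\<And>X Y. \<Omega> X Y - \<Omega>' X Y = coboundary \<eta> X Y"
    "continuous_1cochain \<theta>" "\<And>X Y. \<Psi> X Y - \<Psi>' X Y = coboundary \<theta> X Y"
    using assms unfolding cohomologous_def by blast
  have "\<Omega> X Y + \<Psi> X Y - (\<Omega>' X Y + \<Psi>' X Y) = coboundary (\<lambda>X. \<eta> X + \<theta> X) X Y" for X Y
    using *(2)[of X Y] *(4)[of X Y] by (simp add: coboundary_def algebra_simps)
  then show ?thesis
    using assms continuous_1cochain_add[OF *(1,3)] unfolding cohomologous_def
    by (blast intro: continuous_2cocycle_add)
qed

lemma cohomologous_scale:
  assumes "cohomologous \<Omega> \<Omega>'"
  shows "cohomologous (\<lambda>X Y. c * \<Omega> X Y) (\<lambda>X Y. c * \<Omega>' X Y)"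
proof -
  obtain \<eta> where *: "continuous_1cochain \<eta>" "\<And>X Y. \<Omega> X Y - \<Omega>' X Y = coboundary \<eta> X Y"
    using assms unfolding cohomologous_def by blast
  have "c * \<Omega> X Y - c * \<Omega>' X Y = coboundary (\<lambda>X. c * \<eta> X) X Y" for X Y
    using *(2)[of X Y] by (simp add: coboundary_def flip: right_diff_distrib)
  then show ?thesis
    using assms continuous_1cochain_scale[OF *(1)] unfolding cohomologous_def
    by (blast intro: continuous_2cocycle_scale)
qed

lemma part_equivp_cohomologous: "part_equivp cohomologous"
proof (rule part_equivpI)
  show "\<exists>\<Omega>. cohomologous \<Omega> \<Omega>"
    using cohomologous_refl[OF continuous_2cocycle_zero] by blast
  show "symp cohomologous"
  proof (rule sympI)
    fix \<Omega> \<Omega>' assume A: "cohomologous \<Omega> \<Omega>'"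
    then obtain \<eta> where *: "continuous_1cochain \<eta>" "\<And>X Y. \<Omega> X Y - \<Omega>' X Y = coboundary \<eta> X Y"
      unfolding cohomologous_def by blast
    have "\<Omega>' X Y - \<Omega> X Y = coboundary (\<lambda>X. (-1) * \<eta> X) X Y" for X Y
      using *(2)[of X Y] by (simp add: coboundary_def algebra_simps)
    then show "cohomologous \<Omega>' \<Omega>"
      using A continuous_1cochain_scale[OF *(1), of "-1"] unfolding cohomologous_def by blast
  qed
  show "transp cohomologous"
  proof (rule transpI)
    fix \<Omega> \<Omega>' \<Omega>'' assume A: "cohomologous \<Omega> \<Omega>'" "cohomologous \<Omega>' \<Omega>''"
    then obtain \<eta> \<theta> where *: "continuous_1cochain \<eta>" "\<And>X Y. \<Omega> X Y - \<Omega>' X Y = coboundary \<eta> X Y"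
      "continuous_1cochain \<theta>" "\<And>X Y. \<Omega>' X Y - \<Omega>'' X Y = coboundary \<theta> X Y"
      unfolding cohomologous_def by blast
    have "\<Omega> X Y - \<Omega>'' X Y = coboundary (\<lambda>X. \<eta> X + \<theta> X) X Y" for X Y
      using *(2)[of X Y] *(4)[of X Y] by (simp add: coboundary_def algebra_simps)
    then show "cohomologous \<Omega> \<Omega>''"
      using A continuous_1cochain_add[OF *(1,3)] unfolding cohomologous_def by blast
  qed
qed

text \<open>\<open>H2\<close> is the quotient of the continuous 2-cocycles by the coboundaries; for a continuous
  2-cocycle \<open>\<Omega>\<close> its class is \<open>H2_class \<Omega>\<close> (unspecified on maps that are not cocycles).\<close>

quotient_type H2 = "alg \<Rightarrow> alg \<Rightarrow> complex" / partial: cohomologous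
  morphisms H2_rep H2_class
  by (rule part_equivp_cohomologous)

instantiation H2 :: complex_vector
begin

lift_definition zero_H2 :: H2 is "\<lambda>_ _. 0"
  by (rule cohomologous_refl[OF continuous_2cocycle_zero])
lift_definition plus_H2 :: "H2 \<Rightarrow> H2 \<Rightarrow> H2" is "\<lambda>\<Omega> \<Psi> X Y. \<Omega> X Y + \<Psi> X Y"
  by (rule cohomologous_add)
lift_definition scaleC_H2 :: "complex \<Rightarrow> H2 \<Rightarrow> H2" is "\<lambda>c \<Omega> X Y. c * \<Omega> X Y"
  by (rule cohomologous_scale)
definition scaleR_H2 :: "real \<Rightarrow> H2 \<Rightarrow> H2" where "scaleR_H2 r x = complex_of_real r *\<^sub>C x"
definition uminus_H2 :: "H2 \<Rightarrow> H2" where "uminus_H2 x = (-1) *\<^sub>C x"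
definition minus_H2 :: "H2 \<Rightarrow> H2 \<Rightarrow> H2" where "minus_H2 x y = x + (- y)"

instance
proof
  fix x y z :: H2 and r s :: real and c d :: complex
  have assoc: "x + y + z = x + (y + z)"
    by transfer (simp add: add.assoc cohomologous_add)
  show "x + y + z = x + (y + z)" by (rule assoc)
  show "x + y = y + x"
    by transfer (subst add.commute, rule cohomologous_add)
  show "0 + x = x" by transfer simp
  show "- x + x = 0" unfolding uminus_H2_def
    by transfer (simp add: cohomologous_refl continuous_2cocycle_zero)
  show "x - y = x + - y" by (rule minus_H2_def)
  have ar: "e *\<^sub>C (x + y) = e *\<^sub>C x + e *\<^sub>C y" for e
    by transfer (simp add: distrib_left cohomologous_add cohomologous_scale)
  have al: "(e + e') *\<^sub>C x = e *\<^sub>C x + e' *\<^sub>C x" for e e'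
    by transfer (simp add: distrib_right cohomologous_add cohomologous_scale)
  have sc: "e *\<^sub>C e' *\<^sub>C x = (e * e') *\<^sub>C x" for e e'
    by transfer (simp add: mult.assoc cohomologous_scale)
  have one: "1 *\<^sub>C x = x" by transfer simp
  show "c *\<^sub>C (x + y) = c *\<^sub>C x + c *\<^sub>C y" by (rule ar)
  show "(c + d) *\<^sub>C x = c *\<^sub>C x + d *\<^sub>C x" by (rule al)
  show "c *\<^sub>C d *\<^sub>C x = (c * d) *\<^sub>C x" by (rule sc)
  show "1 *\<^sub>C x = x" by (rule one)
  show "r *\<^sub>R (x + y) = r *\<^sub>R x + r *\<^sub>R y" by (simp add: scaleR_H2_def ar)
  show "(r + s) *\<^sub>R x = r *\<^sub>R x + s *\<^sub>R x" by (simp add: scaleR_H2_def al)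
  show "r *\<^sub>R s *\<^sub>R x = (r * s) *\<^sub>R x" by (simp add: scaleR_H2_def sc)
  show "1 *\<^sub>R x = x" by (simp add: scaleR_H2_def one)
  show "r *\<^sub>R x = complex_of_real r *\<^sub>C x" by (rule scaleR_H2_def)
qed

end

section \<open>Central extensions\<close>

text \<open>The underlying topological vector space of the extension is \<^typ>\<open>alg \<times> complex\<close>, with
  \<open>(X, s)\<close> in the role of \<open>X \<oplus> sc\<close>.\<close>

definition ext_bracket ::
    "(alg \<Rightarrow> alg \<Rightarrow> complex) \<Rightarrow> alg \<times> complex \<Rightarrow> alg \<times> complex \<Rightarrow> alg \<times> complex"
  where "ext_bracket \<Omega> p q = (bracket (fst p) (fst q), \<Omega> (fst p) (fst q))"

definition equivalent_extensions ::
    "(alg \<Rightarrow> alg \<Rightarrow> complex) \<Rightarrow> (alg \<Rightarrow> alg \<Rightarrow> complex) \<Rightarrow> bool"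
  where "equivalent_extensions \<Omega> \<Omega>' \<longleftrightarrow>
    (\<exists>\<Phi> :: alg \<times> complex \<Rightarrow> alg \<times> complex.
      bij \<Phi> \<and> Vector_Spaces.linear scaleC scaleC \<Phi> \<and>
      (\<forall>p q. \<Phi> (ext_bracket \<Omega> p q) = ext_bracket \<Omega>' (\<Phi> p) (\<Phi> q)) \<and>
      continuous_on UNIV \<Phi> \<and> continuous_on UNIV (inv \<Phi>) \<and>
      (\<forall>s. \<Phi> (0, s) = (0, s)) \<and> (\<forall>p. fst (\<Phi> p) = fst p))"

section \<open>The cocycles attached to antisymmetric arrays\<close>

definition antisym_array :: "(nat \<Rightarrow> nat \<Rightarrow> complex) \<Rightarrow> bool"
  where "antisym_array B \<longleftrightarrow> (\<forall>m n. B m n = - B n m)"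

definition summable_antisym_arrays :: "(nat \<Rightarrow> nat \<Rightarrow> complex) set"
  where "summable_antisym_arrays =
    {B. antisym_array B \<and> (\<lambda>(m, n). cmod (B m n)) summable_on UNIV}"

definition Omega :: "(nat \<Rightarrow> nat \<Rightarrow> complex) \<Rightarrow> alg \<Rightarrow> alg \<Rightarrow> complex"
  where "Omega B X Y = (\<Sum>\<^sub>\<infinity>(m, n)\<in>UNIV. alpha m X * alpha n Y * B m n)"

end

theory Submission
  imports Defs
begin

text \<open>For large \<open>n\<close> an element \<open>X\<close> of the algebra sends \<open>e\<^sub>n\<close> to \<open>\<Sum>\<^sub>m \<alpha>\<^sub>m(X) e\<^sub>n\<^sub>+\<^sub>m\<close>, since the
  edge part kills \<open>e\<^sub>n\<close>. Hence \<open>\<bar>\<alpha>\<^sub>m(X)\<bar> \<le> \<parallel>X\<parallel>\<close>, and \<open>XY\<close> and \<open>YX\<close> agree on \<open>e\<^sub>n\<close>, so that every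
  \<open>\<alpha>\<^sub>m\<close> vanishes on brackets; each term of the cocycle identity for \<open>\<Omega>\<^sub>B\<close> is therefore zero.
  Conversely \<open>\<Omega>\<^sub>B(U\<^sup>m, U\<^sup>n) = B\<^sub>m\<^sub>n\<close>, while coboundaries vanish on the commuting pair \<open>U\<^sup>m, U\<^sup>n\<close>, so
  evaluation there is a well-defined functional on cohomology which recovers \<open>B\<close>.\<close>

section \<open>Asymptotic coefficients of an element on basis vectors\<close>

lemma op_of_basis_vec_eventually:
  "\<forall>\<^sub>F n in sequentially. blinfun_apply (op_of X) (basis_vec n)
     = (\<Sum>m | alpha m X \<noteq> 0. alpha m X *\<^sub>C basis_vec (n + m))"
proof -
  let ?S = "\<Sum>m | alpha m X \<noteq> 0. alpha m X *\<^sub>C op_power shift_op m"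
  have "op_of X - ?S \<in> alg_edge"
    using decomposition_alpha[of X] by (simp add: is_decomposition_def)
  then obtain N where N: "\<And>n. n \<ge> N \<Longrightarrow> blinfun_apply (op_of X - ?S) (basis_vec n) = 0"
    using edge_eventually_zero by blast
  have shift: "blinfun_apply (op_power shift_op m) (basis_vec n) = basis_vec (n + m)" for m n
    by (rule ell2_eqI) (auto simp: coord_shift_power basis_vec.rep_eq)
  have "blinfun_apply ?S (basis_vec n) = (\<Sum>m | alpha m X \<noteq> 0. alpha m X *\<^sub>C basis_vec (n + m))" for n
    by (simp add: blinfun.sum_left scaleC_blinfun.rep_eq shift)
  with N show ?thesis
    unfolding eventually_sequentially by (intro exI[of _ N]) (simp add: blinfun.diff_left)
qed

lemma finite_alpha: "finite {m. alpha m X \<noteq> 0}"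
  using decomposition_alpha[of X] by (simp add: is_decomposition_def)

lemma alpha_eventually:
  "\<forall>\<^sub>F n in sequentially. coord (blinfun_apply (op_of X) (basis_vec n)) (n + m) = alpha m X"
  using op_of_basis_vec_eventually[of X]
proof eventually_elim
  case (elim n)
  \<comment> \<open>The vectors \<open>basis_vec (n + k)\<close> are distinct for distinct
    \<open>k\<close>, so coordinate \<open>n + m\<close> sees only the term
    \<open>k = m\<close>.\<close>
  have "coord (blinfun_apply (op_of X) (basis_vec n)) (n + m)
      = (\<Sum>k | alpha k X \<noteq> 0. if k = m then alpha k X else 0)"
    unfolding elim coord_sum
    by (rule sum.cong) (auto simp: scaleC_ell2.rep_eq basis_vec.rep_eq)
  then show ?case
    by (simp add: sum.delta finite_alpha)
qed

text \<open>This replaces the definite description behind \<open>alpha\<close> by a matrix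
  coefficient computed far out; linearity, vanishing on brackets and the values on shift powers all
  follow from it.\<close>

lemma alpha_eqI:
  assumes "\<forall>\<^sub>F n in sequentially. coord (blinfun_apply (op_of X) (basis_vec n)) (n + m) = c"
  shows "alpha m X = c"
proof -
  \<comment> \<open>Two eventual values of one sequence coincide; the equation is free of
    \<open>n\<close>, hence true outright.\<close>
  have "\<forall>\<^sub>F n in sequentially. alpha m X = c"
    using assms alpha_eventually[of X m] by eventually_elim simp
  then show ?thesis by simp
qed

lemma alpha_add: "alpha m (X + Y) = alpha m X + alpha m Y"
proof (rule alpha_eqI)
  show "\<forall>\<^sub>F n in sequentially. coord (blinfun_apply (op_of (X + Y)) (basis_vec n)) (n + m)
      = alpha m X + alpha m Y"
    using alpha_eventually[of X m] alpha_eventually[of Y m]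
    by eventually_elim (simp add: plus_alg.rep_eq blinfun.add_left plus_ell2.rep_eq)
qed

lemma alpha_scaleC: "alpha m (c *\<^sub>C X) = c * alpha m X"
proof (rule alpha_eqI)
  show "\<forall>\<^sub>F n in sequentially. coord (blinfun_apply (op_of (c *\<^sub>C X)) (basis_vec n)) (n + m)
      = c * alpha m X"
    using alpha_eventually[of X m]
    by eventually_elim (simp add: scaleC_alg.rep_eq scaleC_blinfun.rep_eq scaleC_ell2.rep_eq)
qed

lemma norm_basis_vec: "norm (basis_vec n) = 1"
proof -
  have "(\<Sum>k. (cmod (coord (basis_vec n) k))\<^sup>2) = (\<Sum>k\<in>{n}. (cmod (coord (basis_vec n) k))\<^sup>2)"
    by (rule suminf_finite) (auto simp: basis_vec.rep_eq)
  then show ?thesis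
    by (simp add: norm_ell2_def basis_vec.rep_eq)
qed

lemma alpha_le_norm: "cmod (alpha m X) \<le> norm X"
proof -
  obtain n where "coord (blinfun_apply (op_of X) (basis_vec n)) (n + m) = alpha m X"
    using eventually_happens[OF alpha_eventually[of X m]] by auto
  then have "cmod (alpha m X) \<le> norm (blinfun_apply (op_of X) (basis_vec n))"
    using coord_le_norm by metis
  also have "\<dots> \<le> norm X"
    using norm_blinfun[of "op_of X" "basis_vec n"] by (simp add: norm_basis_vec norm_alg.rep_eq)
  finally show ?thesis .
qed

text \<open>Up to the order of summation, the double sum is symmetric in \<open>X\<close> and
  \<open>Y\<close>, which makes commutators invisible far out.\<close>

lemma compose_basis_vec_eventually:
  "\<forall>\<^sub>F n in sequentially. blinfun_apply (op_of X) (blinfun_apply (op_of Y) (basis_vec n))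
     = (\<Sum>j | alpha j Y \<noteq> 0. \<Sum>i | alpha i X \<noteq> 0. (alpha i X * alpha j Y) *\<^sub>C basis_vec (n + i + j))"
proof -
  \<comment> \<open>An explicit threshold is kept because the formula for \<open>X\<close> is
    applied at all indices \<open>n + j\<close>, which stay above \<open>N\<close> since offsets are
    nonnegative.\<close>
  obtain N where N: "\<And>n. n \<ge> N \<Longrightarrow> blinfun_apply (op_of X) (basis_vec n)
      = (\<Sum>i | alpha i X \<noteq> 0. alpha i X *\<^sub>C basis_vec (n + i))"
    using op_of_basis_vec_eventually[of X] unfolding eventually_sequentially by blast
  show ?thesis
    using op_of_basis_vec_eventually[of Y] eventually_ge_at_top[of N]
  proof eventually_elim
    case (elim n)
    have "blinfun_apply (op_of X) (blinfun_apply (op_of Y) (basis_vec n))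
        = (\<Sum>j | alpha j Y \<noteq> 0. alpha j Y *\<^sub>C blinfun_apply (op_of X) (basis_vec (n + j)))"
      by (simp add: elim(1) blinfun.sum_right span_generators_complex_linear[OF op_of])
    also have "\<dots> = (\<Sum>j | alpha j Y \<noteq> 0. \<Sum>i | alpha i X \<noteq> 0. (alpha i X * alpha j Y) *\<^sub>C basis_vec (n + i + j))"
      using elim(2) by (simp add: N cvec.scale_sum_right scaleC_scaleC ac_simps)
    finally show ?case .
  qed
qed

lemma alpha_bracket: "alpha m (bracket X Y) = 0"
proof (rule alpha_eqI)
  show "\<forall>\<^sub>F n in sequentially. coord (blinfun_apply (op_of (bracket X Y)) (basis_vec n)) (n + m) = 0"
    using compose_basis_vec_eventually[of X Y] compose_basis_vec_eventually[of Y X]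
  proof eventually_elim
    case (elim n)
    have "blinfun_apply (op_of X) (blinfun_apply (op_of Y) (basis_vec n))
        = blinfun_apply (op_of Y) (blinfun_apply (op_of X) (basis_vec n))"
      unfolding elim by (subst sum.swap) (simp add: ac_simps)
    then show ?case
      by (simp add: bracket.rep_eq blinfun.diff_left coord_zero)
  qed
qed

section \<open>Shift powers as commuting test elements\<close>

lift_definition shift_alg :: "nat \<Rightarrow> alg" is "op_power shift_op"
  by (rule cvec.span_base) (auto simp: alg_generators_eq)

lemma alpha_shift_alg: "alpha m (shift_alg n) = (if m = n then 1 else 0)"
  by (rule alpha_eqI, rule always_eventually)
    (auto simp: shift_alg.rep_eq coord_shift_power basis_vec.rep_eq)

lemma bracket_shift_alg: "bracket (shift_alg m) (shift_alg n) = 0"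
  by transfer (simp add: shift_shift add.commute)

section \<open>The space of summable antisymmetric arrays\<close>

lemma summable_antisym_array_norm:
  "B \<in> summable_antisym_arrays \<Longrightarrow> (\<lambda>p. cmod (case p of (m, n) \<Rightarrow> B m n)) summable_on UNIV"
  by (simp add: summable_antisym_arrays_def case_prod_unfold)

lemma summable_antisym_array_antisym:
  "B \<in> summable_antisym_arrays \<Longrightarrow> B m n = - B n m"
  unfolding summable_antisym_arrays_def antisym_array_def by blast

lemma finite_support_summable_antisym:
  assumes "antisym_array B" and "finite {(m, n). B m n \<noteq> 0}"
  shows "B \<in> summable_antisym_arrays"
proof -
  have "(\<lambda>(m, n). cmod (B m n)) summable_on {(m, n). B m n \<noteq> 0}"
    using assms(2) by (rule summable_on_finite)
  also have "?this \<longleftrightarrow> (\<lambda>(m, n). cmod (B m n)) summable_on UNIV"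
    by (rule summable_on_cong_neutral) auto
  finally show ?thesis
    using assms(1) by (simp add: summable_antisym_arrays_def)
qed

lemma summable_antisym_arrays_add:
  assumes "B \<in> summable_antisym_arrays" and "B' \<in> summable_antisym_arrays"
  shows "(\<lambda>m n. B m n + B' m n) \<in> summable_antisym_arrays"
proof -
  have "(\<lambda>p. cmod (case p of (m, n) \<Rightarrow> B m n + B' m n)) summable_on UNIV"
    using summable_on_add[OF assms[THEN summable_antisym_array_norm]]
    by (rule Infinite_Sum.abs_summable_on_comparison_test')
      (auto simp: norm_triangle_ineq)
  moreover have "antisym_array (\<lambda>m n. B m n + B' m n)"
    unfolding antisym_array_def minus_add_distrib
    by (intro allI arg_cong2[where f = plus] summable_antisym_array_antisym assms)
  ultimately show ?thesis
    by (simp add: summable_antisym_arrays_def case_prod_unfold)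
qed

lemma summable_antisym_arrays_scale:
  assumes "B \<in> summable_antisym_arrays"
  shows "(\<lambda>m n. c * B m n) \<in> summable_antisym_arrays"
proof -
  have "antisym_array (\<lambda>m n. c * B m n)"
    unfolding antisym_array_def mult_minus_right[symmetric]
    by (intro allI arg_cong2[where f = times] refl summable_antisym_array_antisym assms)
  then show ?thesis
    using summable_on_cmult_right[OF summable_antisym_array_norm[OF assms], of "cmod c"]
    by (simp add: summable_antisym_arrays_def case_prod_unfold norm_mult)
qed

section \<open>Convergence, norm bound and cocycle conditions\<close>

lemma Omega_term_bound:
  "cmod (alpha m X * alpha n Y * B m n) \<le> norm X * norm Y * cmod (B m n)"
  unfolding norm_mult by (intro mult_mono alpha_le_norm mult_nonneg_nonneg) auto

lemma Omega_abs_summable: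
  assumes "B \<in> summable_antisym_arrays"
  shows "(\<lambda>p. cmod (case p of (m, n) \<Rightarrow> alpha m X * alpha n Y * B m n)) summable_on UNIV"
  using summable_on_cmult_right[OF summable_antisym_array_norm[OF assms], of "norm X * norm Y"]
  by (rule Infinite_Sum.abs_summable_on_comparison_test')
    (auto intro: Omega_term_bound)

lemma Omega_summable:
  assumes "B \<in> summable_antisym_arrays"
  shows "(\<lambda>(m, n). alpha m X * alpha n Y * B m n) summable_on UNIV"
  using Omega_abs_summable[OF assms] by (rule abs_summable_summable)

text \<open>The estimate \<open>alpha_le_norm\<close> is uniform in the index, so the norms of
  \<open>X\<close> and \<open>Y\<close> factor out of the majorant and only the sum of the entries
  of \<open>B\<close> in modulus remains.\<close>

lemma Omega_bound:
  assumes "B \<in> summable_antisym_arrays"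
  shows "cmod (Omega B X Y) \<le> (\<Sum>\<^sub>\<infinity>(m, n)\<in>UNIV. cmod (B m n)) * norm X * norm Y"
proof -
  have "cmod (Omega B X Y) \<le> (\<Sum>\<^sub>\<infinity>p\<in>UNIV. cmod (case p of (m, n) \<Rightarrow> alpha m X * alpha n Y * B m n))"
    unfolding Omega_def by (rule norm_infsum_bound[OF Omega_abs_summable[OF assms]])
  also have "\<dots> \<le> (\<Sum>\<^sub>\<infinity>p\<in>UNIV. norm X * norm Y * cmod (case p of (m, n) \<Rightarrow> B m n))"
    by (rule infsum_mono[OF Omega_abs_summable[OF assms]
          summable_on_cmult_right[OF summable_antisym_array_norm[OF assms]]])
      (auto intro: Omega_term_bound)
  also have "\<dots> = norm X * norm Y * (\<Sum>\<^sub>\<infinity>p\<in>UNIV. cmod (case p of (m, n) \<Rightarrow> B m n))"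
    by (rule infsum_cmult_right')
  finally show ?thesis
    by (simp add: case_prod_unfold ac_simps)
qed

lemma Omega_add_left:
  assumes "B \<in> summable_antisym_arrays"
  shows "Omega B (X + X') Y = Omega B X Y + Omega B X' Y"
  using infsum_add[OF Omega_summable[OF assms, of X Y] Omega_summable[OF assms, of X' Y]]
  by (simp add: Omega_def alpha_add case_prod_unfold distrib_right)

lemma Omega_scaleC_left: "Omega B (c *\<^sub>C X) Y = c * Omega B X Y"
  \<comment> \<open>Scalars pass through the infinite sum even when it diverges: its default value 0
    then makes both sides 0.\<close>
  unfolding Omega_def infsum_cmult_right'[symmetric]
  by (simp add: alpha_scaleC case_prod_unfold mult.assoc)

text \<open>Interchanging the two summation indices replaces \<open>B\<close> by its transpose,
  which contributes the sign.\<close>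

lemma Omega_antisym:
  assumes "antisym_array B"
  shows "Omega B X Y = - Omega B Y X"
proof -
  have "Omega B X Y = (\<Sum>\<^sub>\<infinity>p\<in>UNIV. case prod.swap p of (m, n) \<Rightarrow> alpha m X * alpha n Y * B m n)"
    unfolding Omega_def
    by (rule infsum_reindex_bij_betw[symmetric]) (simp add: bij_swap)
  also have "\<dots> = (\<Sum>\<^sub>\<infinity>p\<in>UNIV. - (case p of (m, n) \<Rightarrow> alpha m Y * alpha n X * B m n))"
  proof (rule infsum_cong)
    fix p :: "nat \<times> nat"
    show "(case prod.swap p of (m, n) \<Rightarrow> alpha m X * alpha n Y * B m n)
        = - (case p of (m, n) \<Rightarrow> alpha m Y * alpha n X * B m n)"
      using assms[unfolded antisym_array_def, rule_format, of "snd p" "fst p"]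
      by (simp add: case_prod_unfold)
  qed
  finally show ?thesis
    by (simp add: Omega_def infsum_uminus)
qed

lemma Omega_bracket: "Omega B (bracket X Y) Z = 0"
  by (simp add: Omega_def alpha_bracket case_prod_unfold)

lemma continuous_2cocycle_Omega:
  assumes B: "B \<in> summable_antisym_arrays"
  shows "continuous_2cocycle (Omega B)"
proof -
  have anti: "Omega B X Y = - Omega B Y X" for X Y
    using B by (intro Omega_antisym) (simp add: summable_antisym_arrays_def)
  \<comment> \<open>Linearity in the second argument is carried over from the first by
    antisymmetry.\<close>
  have add_right: "Omega B X (Y + Y') = Omega B X Y + Omega B X Y'" for X Y Y'
    using Omega_add_left[OF B, of Y Y' X] anti[of X "Y + Y'"] anti[of X Y] anti[of X Y'] by simp
  have scale_right: "Omega B X (c *\<^sub>C Y) = c * Omega B X Y" for c X Y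
    using Omega_scaleC_left[of B c Y X] anti[of X "c *\<^sub>C Y"] anti[of X Y] by simp
  have "bounded_bilinear (Omega B)"
  proof
    show "\<exists>K. \<forall>X Y. norm (Omega B X Y) \<le> norm X * norm Y * K"
      using Omega_bound[OF B]
      by (intro exI[of _ "\<Sum>\<^sub>\<infinity>(m, n)\<in>UNIV. cmod (B m n)"] allI) (simp add: ac_simps)
  qed (simp_all add: Omega_add_left[OF B] add_right scaleR_scaleC Omega_scaleC_left scale_right
      scaleC_complex_def)
  then show ?thesis
    unfolding continuous_2cocycle_def
    by (intro conjI allI anti) (simp_all add: Omega_scaleC_left scale_right Omega_bracket)
qed

section \<open>Recovering the array from its cohomology class\<close>

lemma Omega_shift_alg: "Omega B (shift_alg m) (shift_alg n) = B m n"
proof -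
  \<comment> \<open>The coefficients of a shift power are Kronecker deltas, so every term off the
    index pair \<open>(m, n)\<close> is zero.\<close>
  have "Omega B (shift_alg m) (shift_alg n)
      = (\<Sum>\<^sub>\<infinity>(i, j)\<in>{(m, n)}. alpha i (shift_alg m) * alpha j (shift_alg n) * B i j)"
    unfolding Omega_def by (rule infsum_cong_neutral) (auto simp: alpha_shift_alg split: if_splits)
  then show ?thesis by (simp add: alpha_shift_alg)
qed

lemma Omega_array_add:
  assumes "B \<in> summable_antisym_arrays" and "B' \<in> summable_antisym_arrays"
  shows "Omega (\<lambda>m n. B m n + B' m n) = (\<lambda>X Y. Omega B X Y + Omega B' X Y)"
  using infsum_add[OF Omega_summable[OF assms(1)] Omega_summable[OF assms(2)]]
  by (intro ext) (simp add: Omega_def case_prod_unfold distrib_left)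

lemma Omega_array_scale: "Omega (\<lambda>m n. c * B m n) = (\<lambda>X Y. c * Omega B X Y)"
  unfolding Omega_def infsum_cmult_right'[symmetric]
  by (simp add: case_prod_unfold ac_simps)

lift_definition shift_eval :: "nat \<Rightarrow> nat \<Rightarrow> H2 \<Rightarrow> complex"
  is "\<lambda>m n \<Omega>. \<Omega> (shift_alg m) (shift_alg n)"
proof -
  fix m n and \<Omega> \<Omega>' :: "alg \<Rightarrow> alg \<Rightarrow> complex"
  assume "cohomologous \<Omega> \<Omega>'"
  then obtain \<eta> where "bounded_linear \<eta>" and "\<And>X Y. \<Omega> X Y - \<Omega>' X Y = \<eta> (bracket X Y)"
    by (auto simp: cohomologous_def continuous_1cochain_def coboundary_def)
  \<comment> \<open>The difference is \<open>\<eta> 0\<close>, because the shift powers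
    commute.\<close>
  then show "\<Omega> (shift_alg m) (shift_alg n) = \<Omega>' (shift_alg m) (shift_alg n)"
    by (metis bracket_shift_alg eq_iff_diff_eq_0 linear_simps(3))
qed

lemma shift_eval_0: "shift_eval m n 0 = 0"
  by transfer simp

lemma shift_eval_add: "shift_eval m n (x + y) = shift_eval m n x + shift_eval m n y"
  by transfer simp

lemma shift_eval_scaleC: "shift_eval m n (c *\<^sub>C x) = c * shift_eval m n x"
  by transfer simp

lemma shift_eval_Omega:
  assumes "B \<in> summable_antisym_arrays"
  shows "shift_eval m n (H2_class (Omega B)) = B m n"
  \<comment> \<open>The quotient is partial: a lifted function may be evaluated on a representative
    only if it is related to itself, that is, if it is a cocycle.\<close>
  using shift_eval.abs_eq[of "Omega B"] cohomologous_refl[OF continuous_2cocycle_Omega[OF assms]]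
  by (simp add: eq_onp_def Omega_shift_alg)

lemma H2_class_add:
  assumes "continuous_2cocycle \<Omega>" and "continuous_2cocycle \<Psi>"
  shows "H2_class (\<lambda>X Y. \<Omega> X Y + \<Psi> X Y) = H2_class \<Omega> + H2_class \<Psi>"
  using assms by (simp add: plus_H2.abs_eq cohomologous_refl)

lemma H2_class_scale:
  assumes "continuous_2cocycle \<Omega>"
  shows "H2_class (\<lambda>X Y. c * \<Omega> X Y) = c *\<^sub>C H2_class \<Omega>"
  using assms by (simp add: scaleC_H2.abs_eq cohomologous_refl)

text \<open>The functionals \<open>shift_eval m n\<close> on cohomology read off every entry of
  \<open>B\<close>.\<close>

lemma inj_on_H2_class_Omega: "inj_on (\<lambda>B. H2_class (Omega B)) summable_antisym_arrays"
  by (intro inj_onI ext) (metis shift_eval_Omega)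

section \<open>Infinite dimension of the cohomology\<close>

definition unit_array :: "nat \<Rightarrow> nat \<Rightarrow> nat \<Rightarrow> complex"
  where "unit_array k m n = (if m = 0 \<and> n = Suc k then 1 else if m = Suc k \<and> n = 0 then -1 else 0)"

text \<open>The two nonzero entries are mirror images with opposite signs; \<open>Suc k\<close>
  keeps them off the diagonal, where antisymmetry forces zeros.\<close>

lemma unit_array_summable: "unit_array k \<in> summable_antisym_arrays"
proof (rule finite_support_summable_antisym)
  show "antisym_array (unit_array k)"
    by (auto simp: antisym_array_def unit_array_def)
  have "{(m, n). unit_array k m n \<noteq> 0} \<subseteq> {(0, Suc k), (Suc k, 0)}"
    by (auto simp: unit_array_def split: if_splits)
  then show "finite {(m, n). unit_array k m n \<noteq> 0}"
    by (rule finite_subset) simp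
qed

text \<open>The classes of the unit arrays and the functionals \<open>shift_eval 0 (Suc k)\<close>
  are biorthogonal, which gives infinitely many independent classes.\<close>

lemma H2_infinite_dimensional: "\<not> (\<exists>S :: H2 set. finite S \<and> cvec.span S = UNIV)"
proof
  assume "\<exists>S :: H2 set. finite S \<and> cvec.span S = UNIV"
  then obtain S :: "H2 set" where S: "finite S" "cvec.span S = UNIV" by blast
  define v where "v k = H2_class (Omega (unit_array k))" for k
  have eval: "shift_eval 0 (Suc k) (v j) = (if j = k then 1 else 0)" for j k
    by (simp add: v_def shift_eval_Omega[OF unit_array_summable] unit_array_def)
  have "cvec.independent (range v)"
  proof
    assume "cvec.dependent (range v)"
    then obtain k where k: "v k \<in> cvec.span (range v - {v k})"
      unfolding cvec.dependent_def by blast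
    \<comment> \<open>The \<open>k\<close>-th functional kills all other classes and hence their
      span, yet equals 1 on \<open>v k\<close>.\<close>
    have "shift_eval 0 (Suc k) x = 0" if "x \<in> cvec.span (range v - {v k})" for x
      using that
    proof (induction rule: cvec.span_induct_alt)
      case base
      show ?case by (rule shift_eval_0)
    next
      case (step c x y)
      then obtain j where "x = v j" "j \<noteq> k" by auto
      with step show ?case by (simp add: shift_eval_add shift_eval_scaleC eval)
    qed
    from this[OF k] show False by (simp add: eval)
  qed
  then have "finite (range v)"
    using cvec.independent_span_bound[OF S(1)] S(2) by blast
  \<comment> \<open>Independence concerns only the set \<open>range v\<close>; injectivity makes
    this set infinite.\<close>
  moreover have "inj v"
    using eval by (metis injI zero_neq_one)
  ultimately show False
    using finite_imageD by blast
qed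

section \<open>Inequivalence of the central extensions\<close>

lemma equivalent_extensions_shift_alg:
  assumes "equivalent_extensions \<Omega> \<Omega>'"
  shows "\<Omega> (shift_alg m) (shift_alg n) = \<Omega>' (shift_alg m) (shift_alg n)"
proof -
  obtain \<Phi> where hom: "\<And>p q. \<Phi> (ext_bracket \<Omega> p q) = ext_bracket \<Omega>' (\<Phi> p) (\<Phi> q)"
    and central: "\<And>s. \<Phi> (0, s) = (0, s)" and over: "\<And>p. fst (\<Phi> p) = fst p"
    using assms unfolding equivalent_extensions_def by blast
  show ?thesis
    \<comment> \<open>The lifts bracket to a purely central element, which \<open>\<Phi>\<close>
      fixes. On the other side \<open>\<Phi>\<close> may alter the lifts only in their central
      components, and \<open>ext_bracket\<close> ignores those.\<close>
    using hom[of "(shift_alg m, 0)" "(shift_alg n, 0)"]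
    by (simp add: ext_bracket_def over central bracket_shift_alg)
qed

theorem proposition3p9:
  shows
    "(\<forall>B. antisym_array B \<and> finite {(m, n). B m n \<noteq> 0} \<longrightarrow> B \<in> summable_antisym_arrays) \<and>
     (\<forall>B\<in>summable_antisym_arrays.
        continuous_2cocycle (Omega B) \<and>
        (\<forall>X Y. cmod (Omega B X Y) \<le> (\<Sum>\<^sub>\<infinity>(m, n)\<in>UNIV. cmod (B m n)) * norm X * norm Y)) \<and>
     (\<forall>B\<in>summable_antisym_arrays. \<forall>B'\<in>summable_antisym_arrays.
        (\<lambda>m n. B m n + B' m n) \<in> summable_antisym_arrays \<and>
        H2_class (Omega (\<lambda>m n. B m n + B' m n)) = H2_class (Omega B) + H2_class (Omega B')) \<and>
     (\<forall>c. \<forall>B\<in>summable_antisym_arrays.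
        (\<lambda>m n. c * B m n) \<in> summable_antisym_arrays \<and>
        H2_class (Omega (\<lambda>m n. c * B m n)) = c *\<^sub>C H2_class (Omega B)) \<and>
     inj_on (\<lambda>B. H2_class (Omega B)) summable_antisym_arrays \<and>
     \<not> (\<exists>S :: H2 set. finite S \<and> cvec.span S = UNIV) \<and>
     pairwise (\<lambda>B B'. \<not> equivalent_extensions (Omega B) (Omega B')) summable_antisym_arrays"
proof (intro conjI ballI allI impI)
  show "pairwise (\<lambda>B B'. \<not> equivalent_extensions (Omega B) (Omega B')) summable_antisym_arrays"
  proof (rule pairwiseI, rule notI)
    fix B B'
    assume "B \<noteq> B'" and "equivalent_extensions (Omega B) (Omega B')"
    \<comment> \<open>Equivalence makes the cocycles agree at all pairs of shift powers, so all
      entries of \<open>B\<close> and \<open>B'\<close> agree.\<close>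
    then show False
      using equivalent_extensions_shift_alg[of "Omega B" "Omega B'"] by (auto simp: Omega_shift_alg fun_eq_iff)
  qed
next
  fix B B' assume B: "B \<in> summable_antisym_arrays" "B' \<in> summable_antisym_arrays"
  show "H2_class (Omega (\<lambda>m n. B m n + B' m n)) = H2_class (Omega B) + H2_class (Omega B')"
    unfolding Omega_array_add[OF B] by (intro H2_class_add continuous_2cocycle_Omega B)
next
  show "\<not> (\<exists>S :: H2 set. finite S \<and> cvec.span S = UNIV)"
    by (rule H2_infinite_dimensional)
next
  fix c B assume B: "B \<in> summable_antisym_arrays"
  show "H2_class (Omega (\<lambda>m n. c * B m n)) = c *\<^sub>C H2_class (Omega B)"
    unfolding Omega_array_scale by (intro H2_class_scale continuous_2cocycle_Omega B)
qed (blast intro: finite_support_summable_antisym continuous_2cocycle_Omega Omega_bound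
    summable_antisym_arrays_add summable_antisym_arrays_scale inj_on_H2_class_Omega)+

end
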